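(* Let $n,k\ge 1$. A classical Turing machine $T\in\mathrm{TM}(\mathbb{Z},n,k)$ is reversible if and only if it can be expressed in the form $T_1\circ T_0$, where $T_0$ is a state-symbol permutation and $T_1$ is a state-dependent shift. In particular, classical reversible Turing machines are in $\mathrm{EL}(\mathbb{Z},n,k)$.
   Context: Let $\Sigma=\{0,\dots,n-1\}$ (tape symbols), $Q=\{1,\dots,k\}$ (states). The shift on $\Sigma^{\mathbb{Z}}$ is $(\sigma^{v}(x))_{u}=x_{u-v}$. A moving head $(\mathbb{Z},n,k)$-Turing machine is a map $T:\Sigma^{\mathbb{Z}}\times Q\times\mathbb{Z}\to\Sigma^{\mathbb{Z}}\times Q\times\mathbb{Z}$ (a triple is tape, state, head position) for which there are finite sets $F_{\rm in},F_{\rm out}\subset\mathbb{Z}$ and a function (local rule) $f:\Sigma^{F_{\rm in}}\times Q\to\Sigma^{F_{\rm out}}\times Q\times\mathbb{Z}$ such that $T(x,q,v)=(\tilde x,\tilde q,v+\tilde u)$, where $(\tilde p,\tilde q,\tilde u)=f(\sigma^{-v}(x)|_{F_{\rm in}},q)$, and $\tilde x_{u}=\tilde p_{u-v}$ if $u-v\in F_{\rm out}$, $\tilde x_u=x_u$ otherwise. $\mathrm{TM}(\mathbb{Z},n,k)$ is the monoid of these machines; $T$ is reversible if it has a two-sided inverse in $\mathrm{TM}(\mathbb{Z},n,k)$, and $\mathrm{RTM}(\mathbb{Z},n,k)$ is the group of reversible ones. $T$ is classical if it has a local rule with $F_{\rm in}=F_{\rm out}=\{0\}$ and head displacements in $\{-1,0,1\}$,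 i.e. $f:\Sigma\times Q\to\Sigma\times Q\times\{-1,0,1\}$. A state-symbol permutation is a machine that never moves the head and only applies a fixed permutation of $\Sigma\times Q$ to the pair (symbol under the head, state). A state-dependent shift is a machine in $\mathrm{RFA}(\mathbb{Z},n,k)$ whose local rule does not depend on the tape, never modifies the tape, and only makes movements in $\{-1,0,1\}$. $\mathrm{LP}(\mathbb{Z},n,k)$ is the subgroup of $\mathrm{RTM}(\mathbb{Z},n,k)$ of machines that never move the head; $\mathrm{RFA}(\mathbb{Z},n,k)$ is the subgroup of machines that never change the tape; $\mathrm{EL}(\mathbb{Z},n,k)=\langle\mathrm{RFA}(\mathbb{Z},n,k),\mathrm{LP}(\mathbb{Z},n,k)\rangle$. *)

theory Defs
  imports "HOL-Algebra.Generated_Groups"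
begin

text \<open>
  The tape alphabet and the state set are finite types \<open>'s\<close> and \<open>'q\<close>, so \<open>n = CARD('s)\<close> and
  \<open>k = CARD('q)\<close>; every type is nonempty, which is the assumption \<open>n, k \<ge> 1\<close>.
\<close>

type_synonym ('s, 'q) conf = "(int \<Rightarrow> 's) \<times> 'q \<times> int"

type_synonym ('s, 'q) machine = "('s, 'q) conf \<Rightarrow> ('s, 'q) conf"

type_synonym ('s, 'q) rule = "(int \<Rightarrow> 's) \<times> 'q \<Rightarrow> (int \<Rightarrow> 's) \<times> 'q \<times> int"

definition shift :: "int \<Rightarrow> (int \<Rightarrow> 's) \<Rightarrow> int \<Rightarrow> 's" where
  "shift v x = (\<lambda>u. x (u - v))"

text \<open>
  Finite patterns are represented by total functions \<open>int \<Rightarrow> 's\<close>: only the values of a rule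
  on \<open>Fin \<rightarrow>\<^sub>E UNIV\<close> (patterns that are \<open>undefined\<close> outside \<open>Fin\<close>) matter, and only the
  restriction of the output pattern to \<open>Fout\<close> is used.
\<close>

definition local_rule ::
    "int set \<Rightarrow> int set \<Rightarrow> ('s, 'q) rule \<Rightarrow> ('s, 'q) machine \<Rightarrow> bool" where
  "local_rule Fin Fout f T \<longleftrightarrow>
     finite Fin \<and> finite Fout \<and>
     (\<forall>x q v. T (x, q, v) =
        (let (p', q', u') = f (restrict (shift (- v) x) Fin, q)
         in ((\<lambda>u. if u - v \<in> Fout then p' (u - v) else x u), q', v + u')))"

definition rule_moves_in :: "int set \<Rightarrow> int set \<Rightarrow> ('s, 'q) rule \<Rightarrow> bool" where
  "rule_moves_in D Fin f \<longleftrightarrow> (\<forall>p \<in> Fin \<rightarrow>\<^sub>E UNIV. \<forall>q. snd (snd (f (p, q))) \<in> D)"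

definition TM :: "('s::finite, 'q::finite) machine monoid" where
  "TM = \<lparr>carrier = {T. \<exists>Fin Fout f. local_rule Fin Fout f T}, mult = (\<circ>), one = id\<rparr>"

lemma local_rule_comp:
  fixes T1 T2 :: "('s::finite, 'q::finite) machine"
  assumes 1: "local_rule F1 G1 f1 T1" and 2: "local_rule F2 G2 f2 T2"
  shows "\<exists>Fin Fout f. local_rule Fin Fout f (T2 \<circ> T1)"
proof -
  define D where "D = (\<lambda>a. snd (snd (f1 a))) ` ((F1 \<rightarrow>\<^sub>E UNIV) \<times> UNIV)"
  define Fout where "Fout = G1 \<union> (\<Union>d\<in>D. (+) d ` G2)"
  define Fin where "Fin = F1 \<union> (\<Union>d\<in>D. (+) d ` F2) \<union> Fout"
  define f :: "('s, 'q) rule" where "f = (\<lambda>(p, q).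
     let (p1, q1, u1) = f1 (restrict p F1, q);
         y = (\<lambda>u. if u \<in> G1 then p1 u else p u);
         (p2, q2, u2) = f2 (restrict (shift (- u1) y) F2, q1)
     in ((\<lambda>u. if u - u1 \<in> G2 then p2 (u - u1) else y u), q2, u1 + u2))"
  have fin: "finite F1" "finite G1" "finite F2" "finite G2"
    using 1 2 by (auto simp: local_rule_def)
  have D: "finite D"
    unfolding D_def by (intro finite_imageI finite_cartesian_product finite_PiE fin) auto
  have Fo: "finite Fout" unfolding Fout_def using fin D by auto
  have Fi: "finite Fin" unfolding Fin_def using fin D Fo by auto
  have e1: "T1 (x, q, v) = (let (p', q', u') = f1 (restrict (shift (- v) x) F1, q)
         in ((\<lambda>u. if u - v \<in> G1 then p' (u - v) else x u), q', v + u'))" for x q v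
    using 1 by (auto simp: local_rule_def)
  have e2: "T2 (x, q, v) = (let (p', q', u') = f2 (restrict (shift (- v) x) F2, q)
         in ((\<lambda>u. if u - v \<in> G2 then p' (u - v) else x u), q', v + u'))" for x q v
    using 2 by (auto simp: local_rule_def)
  have "(T2 \<circ> T1) (x, q, v) = (let (p', q', u') = f (restrict (shift (- v) x) Fin, q)
         in ((\<lambda>u. if u - v \<in> Fout then p' (u - v) else x u), q', v + u'))" for x q v
  proof -
    obtain p1 q1 u1 where f1: "f1 (restrict (shift (- v) x) F1, q) = (p1, q1, u1)"
      by (metis prod_cases3)
    have u1: "u1 \<in> D" unfolding D_def
      by (rule image_eqI[where x = "(restrict (shift (- v) x) F1, q)"]) (simp_all add: f1)
    have sub: "F1 \<subseteq> Fin" "Fout \<subseteq> Fin" "(+) u1 ` F2 \<subseteq> Fin" "G1 \<subseteq> Fout" "(+) u1 ` G2 \<subseteq> Fout"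
      using u1 by (auto simp: Fin_def Fout_def)
    define p where "p = restrict (shift (- v) x) Fin"
    define y where "y = (\<lambda>u. if u \<in> G1 then p1 u else p u)"
    define Y where "Y = (\<lambda>u. if u - v \<in> G1 then p1 (u - v) else x u)"
    have r1: "restrict p F1 = restrict (shift (- v) x) F1"
      using sub by (auto simp: p_def restrict_def fun_eq_iff)
    have r2: "restrict (shift (- u1) y) F2 = restrict (shift (- (v + u1)) Y) F2"
    proof
      fix w
      have "w \<in> F2 \<Longrightarrow> u1 + w \<in> Fin" using sub by auto
      then show "restrict (shift (- u1) y) F2 w = restrict (shift (- (v + u1)) Y) F2 w"
        by (auto simp: p_def y_def Y_def shift_def restrict_def algebra_simps)
    qed
    obtain p2 q2 u2 where f2: "f2 (restrict (shift (- u1) y) F2, q1) = (p2, q2, u2)"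
      by (metis prod_cases3)
    have T: "(T2 \<circ> T1) (x, q, v) =
       ((\<lambda>u. if u - (v + u1) \<in> G2 then p2 (u - (v + u1)) else Y u), q2, v + u1 + u2)"
      using f2 by (simp add: e1 f1 e2 r2 flip: Y_def)
    have f: "f (p, q) = ((\<lambda>u. if u - u1 \<in> G2 then p2 (u - u1) else y u), q2, u1 + u2)"
      using f2 unfolding y_def by (simp add: f_def r1 f1 Let_def)
    have "(if u - (v + u1) \<in> G2 then p2 (u - (v + u1)) else Y u) =
       (if u - v \<in> Fout then (if u - v - u1 \<in> G2 then p2 (u - v - u1) else y (u - v)) else x u)" for u
    proof (cases "u - v \<in> Fout")
      case True
      then have "p (u - v) = x u" using sub by (auto simp: p_def shift_def)
      then show ?thesis using True by (auto simp: Y_def y_def algebra_simps)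
    next
      case False
      moreover have "u - (v + u1) \<notin> G2"
      proof
        assume "u - (v + u1) \<in> G2"
        then have "u1 + (u - (v + u1)) \<in> Fout" using sub by blast
        with False show False by (simp add: algebra_simps)
      qed
      ultimately show ?thesis using sub by (auto simp: Y_def)
    qed
    then show ?thesis unfolding T p_def[symmetric] f by (simp add: fun_eq_iff add.assoc)
  qed
  then have "local_rule Fin Fout f (T2 \<circ> T1)"
    unfolding local_rule_def using Fi Fo by blast
  then show ?thesis by blast
qed

lemma monoid_TM: "monoid (TM :: ('s::finite, 'q::finite) machine monoid)"
proof
  show "\<one>\<^bsub>TM\<^esub> \<in> carrier (TM :: ('s, 'q) machine monoid)"
  proof -
    have "local_rule {} {} (\<lambda>(p, q). (p, q, 0)) (id :: ('s, 'q) machine)"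
      by (simp add: local_rule_def)
    then show ?thesis unfolding TM_def by auto
  qed
next
  fix x y :: "('s, 'q) machine" assume "x \<in> carrier TM" "y \<in> carrier TM"
  then show "x \<otimes>\<^bsub>TM\<^esub> y \<in> carrier TM"
    using local_rule_comp unfolding TM_def by fastforce
qed (auto simp: TM_def o_assoc)

definition RTM :: "('s::finite, 'q::finite) machine monoid" where
  "RTM = units_of TM"

lemma group_RTM: "group (RTM :: ('s::finite, 'q::finite) machine monoid)"
  unfolding RTM_def by (rule monoid.units_group[OF monoid_TM])

definition LP :: "('s::finite, 'q::finite) machine set" where
  "LP = {T \<in> carrier RTM. \<forall>x q v. snd (snd (T (x, q, v))) = v}"

definition RFA :: "('s::finite, 'q::finite) machine set" where
  "RFA = {T \<in> carrier RTM. \<forall>x q v. fst (T (x, q, v)) = x}"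

definition EL :: "('s::finite, 'q::finite) machine set" where
  "EL = generate RTM (RFA \<union> LP)"

definition reversible :: "('s::finite, 'q::finite) machine \<Rightarrow> bool" where
  "reversible T \<longleftrightarrow> T \<in> Units TM"

definition classical :: "('s::finite, 'q::finite) machine \<Rightarrow> bool" where
  "classical T \<longleftrightarrow> (\<exists>f. local_rule {0} {0} f T \<and> rule_moves_in {-1, 0, 1} {0} f)"

definition state_symbol_permutation :: "('s::finite, 'q::finite) machine \<Rightarrow> bool" where
  "state_symbol_permutation T \<longleftrightarrow>
     (\<exists>\<pi> :: 's \<times> 'q \<Rightarrow> 's \<times> 'q. bij \<pi> \<and>
        local_rule {0} {0} (\<lambda>(p, q). let (b, r) = \<pi> (p 0, q) in ((\<lambda>_. b), r, 0)) T)"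

text \<open>
  That the local rule neither depends on the tape nor modifies it is expressed by taking both
  windows to be empty.
\<close>

definition state_dependent_shift :: "('s::finite, 'q::finite) machine \<Rightarrow> bool" where
  "state_dependent_shift T \<longleftrightarrow>
     T \<in> RFA \<and> (\<exists>f. local_rule {} {} f T \<and> rule_moves_in {-1, 0, 1} {} f)"

end

theory Submission imports Defs begin

text \<open>
  A classical machine is given by a function \<open>g\<close> that sends (symbol under the head, state) to
  (new symbol, new state, displacement). Any two steps that end in the same state can be made to end
  in the same configuration: fix the final head position, step backwards by each displacement, and
  choose a tape carrying the required written symbol in each of the two cells where the head would
  have come from. If the displacements differ, these cells are distinct, so there is no conflict,
  and the configuration obtained has two preimages with different head positions. Hence injectivity
  of the machine forces the displacement to be a function \<open>\<delta>\<close> of the new state alone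
  (\<open>displacement_determined_by_state\<close>). Once it is, two steps that agree in new symbol and new state
  come from the same cell, so (symbol, state) is mapped injectively to (new symbol, new state)
  (\<open>inj_write\<close>), and by finiteness this map is a permutation. The machine then
  first applies the permutation and afterwards moves the head by \<open>\<delta>\<close> of the state.

  Conversely, both factors are invertible machines of the same kind, given by the inverse permutation
  and by \<open>-\<delta>\<close>; the first lies in \<open>LP\<close> and the second in \<open>RFA\<close>, which also gives membership in
  \<open>EL\<close>.
\<close>

definition head_machine :: "('s \<times> 'q \<Rightarrow> 's \<times> 'q \<times> int) \<Rightarrow> ('s, 'q) machine" where
  "head_machine g = (\<lambda>(x, q, v). let (b, r, d) = g (x v, q) in (x(v := b), r, v + d))"

definition head_permutation :: "('s \<times> 'q \<Rightarrow> 's \<times> 'q) \<Rightarrow> ('s, 'q) machine" where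
  "head_permutation \<pi> = (\<lambda>(x, q, v). let (b, r) = \<pi> (x v, q) in (x(v := b), r, v))"

definition state_shift :: "('q \<Rightarrow> int) \<Rightarrow> ('s, 'q) machine" where
  "state_shift \<delta> = (\<lambda>(x, q, v). (x, q, v + \<delta> q))"

lemma carrier_RTM: "carrier RTM = Units TM"
  by (simp add: RTM_def units_of_carrier)

lemma one_TM: "\<one>\<^bsub>TM\<^esub> = id"
  by (simp add: TM_def)

lemma mult_TM: "S \<otimes>\<^bsub>TM\<^esub> T = S \<circ> T"
  by (simp add: TM_def)

lemma reversible_imp_inj:
  assumes "reversible T"
  shows "inj T"
proof -
  obtain S where "S \<otimes>\<^bsub>TM\<^esub> T = \<one>\<^bsub>TM\<^esub>"
    using assms unfolding reversible_def Units_def by blast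
  then have "S \<circ> T = id"
    by (simp add: one_TM mult_TM)
  then show ?thesis
    by (metis inj_on_id inj_on_imageI2)
qed

section \<open>Machines with a one-cell window\<close>

text \<open>
  With a one-cell input window the pattern read is determined by the symbol under the head, and with a
  one-cell output window only the value of the output pattern at 0 is written. So a function on
  symbols and states replaces the rule on patterns, and the remaining arguments need no
  restricted functions.
\<close>

lemma classical_imp_head_machine:
  assumes "classical T"
  obtains g where "T = head_machine g" and "\<And>s. snd (snd (g s)) \<in> {-1, 0, 1}"
proof -
  obtain f where f: "local_rule {0} {0} f T" "rule_moves_in {-1, 0, 1} {0} f"
    using assms unfolding classical_def by blast
  define g where "g = (\<lambda>(a, q). let (p, r, d) = f (restrict (\<lambda>_. a) {0}, q) in (p 0, r, d))"
  have cell: "restrict (shift (- v) x) {0} = restrict (\<lambda>_. x v) {0}" for x :: "int \<Rightarrow> 'a" and v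
    by (auto simp: shift_def restrict_def fun_eq_iff)
  have "T (x, q, v) = head_machine g (x, q, v)" for x q v
    using f(1) unfolding local_rule_def
    by (auto simp: head_machine_def g_def cell Let_def fun_eq_iff split: prod.split)
  moreover have "snd (snd (g s)) \<in> {-1, 0, 1}" for s
  proof -
    have "snd (snd (g s)) = snd (snd (f (restrict (\<lambda>_. fst s) {0}, snd s)))"
      by (simp add: g_def split: prod.split)
    then show ?thesis
      using f(2) unfolding rule_moves_in_def by simp
  qed
  ultimately show ?thesis
    by (intro that[of g]) auto
qed

lemma local_rule_permutation_iff:
  "local_rule {0} {0} (\<lambda>(p, q). let (b, r) = \<pi> (p 0, q) in ((\<lambda>_. b), r, 0)) T
     \<longleftrightarrow> T = head_permutation \<pi>"
proof -
  have "T = head_permutation \<pi> \<longleftrightarrow> (\<forall>x q v. T (x, q, v) = head_permutation \<pi> (x, q, v))"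
    by (auto simp: fun_eq_iff)
  moreover have "(let (p', q', u') = (\<lambda>(p, q). let (b, r) = \<pi> (p 0, q) in ((\<lambda>_. b), r, 0))
                       (restrict (shift (- v) x) {0}, q)
                  in ((\<lambda>u. if u - v \<in> {0} then p' (u - v) else x u), q', v + u'))
                = head_permutation \<pi> (x, q, v)" for x q v
    by (cases "\<pi> (x v, q)") (auto simp: head_permutation_def shift_def)
  ultimately show ?thesis
    by (simp add: local_rule_def)
qed

lemma state_symbol_permutation_iff:
  "state_symbol_permutation T \<longleftrightarrow> (\<exists>\<pi>. bij \<pi> \<and> T = head_permutation \<pi>)"
  unfolding state_symbol_permutation_def local_rule_permutation_iff ..

lemma head_permutation_in_TM: "head_permutation \<pi> \<in> carrier TM"
  using local_rule_permutation_iff[of \<pi> "head_permutation \<pi>"] by (auto simp: TM_def)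

lemma local_rule_state_shift: "local_rule {} {} (\<lambda>(p, q). (p, q, \<delta> q)) (state_shift \<delta>)"
  by (simp add: local_rule_def state_shift_def)

lemma state_shift_in_TM: "state_shift \<delta> \<in> carrier TM"
  using local_rule_state_shift[of \<delta>] by (auto simp: TM_def)

section \<open>The two kinds of factors\<close>

lemma head_permutation_comp:
  "head_permutation \<rho> \<circ> head_permutation \<pi> = head_permutation (\<rho> \<circ> \<pi>)"
  by (auto simp: head_permutation_def fun_eq_iff split: prod.split)

lemma head_permutation_id: "head_permutation id = id"
  by (auto simp: head_permutation_def fun_eq_iff)

lemma head_permutation_in_LP:
  assumes "bij \<pi>"
  shows "head_permutation \<pi> \<in> LP"
proof -
  have "inv_into UNIV \<pi> \<circ> \<pi> = id" "\<pi> \<circ> inv_into UNIV \<pi> = id"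
    using assms by (simp_all add: bij_is_inj surj_iff[THEN iffD1, OF bij_is_surj])
  then have "head_permutation \<pi> \<in> Units TM"
    unfolding Units_def one_TM mult_TM
    using head_permutation_in_TM[of \<pi>] head_permutation_in_TM[of "inv_into UNIV \<pi>"]
    by (auto simp: head_permutation_comp head_permutation_id
        intro!: bexI[of _ "head_permutation (inv_into UNIV \<pi>)"])
  then show ?thesis
    by (simp add: LP_def carrier_RTM head_permutation_def split: prod.split)
qed

lemma state_shift_in_RFA: "state_shift \<delta> \<in> RFA"
proof -
  have "state_shift \<delta> \<in> Units TM"
    unfolding Units_def one_TM mult_TM
    using state_shift_in_TM[of \<delta>] state_shift_in_TM[of "\<lambda>q. - \<delta> q"]
    by (auto simp: state_shift_def fun_eq_iff intro!: bexI[of _ "state_shift (\<lambda>q. - \<delta> q)"])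
  then show ?thesis
    by (simp add: RFA_def carrier_RTM state_shift_def)
qed

lemma state_dependent_shift_state_shift:
  assumes "\<And>q. \<delta> q \<in> {-1, 0, 1}"
  shows "state_dependent_shift (state_shift \<delta>)"
proof -
  have "rule_moves_in {-1, 0, 1} {} (\<lambda>(p, q). (p, q, \<delta> q))"
    using assms by (simp add: rule_moves_in_def)
  then show ?thesis
    using local_rule_state_shift state_shift_in_RFA unfolding state_dependent_shift_def by blast
qed

lemma permutation_then_shift_in_EL:
  assumes "state_symbol_permutation T0" and "state_dependent_shift T1"
  shows "T1 \<circ> T0 \<in> EL"
proof -
  have "T1 \<in> RFA" "T0 \<in> LP"
    using assms head_permutation_in_LP
    by (auto simp: state_dependent_shift_def state_symbol_permutation_iff)
  then have "T1 \<otimes>\<^bsub>RTM\<^esub> T0 \<in> generate RTM (RFA \<union> LP)"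
    by (intro generate.eng generate.incl) auto
  then show ?thesis
    by (simp add: EL_def RTM_def units_of_mult mult_TM)
qed

text \<open>
  Reversibility of a composition of the two factors comes from \<open>EL\<close> being generated inside the group
  of reversible machines, so no inverse of the composition has to be written down.
\<close>

lemma EL_subset_reversible:
  assumes "T \<in> EL"
  shows "reversible T"
proof -
  have "EL \<subseteq> carrier RTM"
    unfolding EL_def
    by (rule group.generate_incl[OF group_RTM]) (auto simp: RFA_def LP_def)
  with assms show ?thesis
    by (auto simp: reversible_def carrier_RTM)
qed

section \<open>Injective machines with a one-cell window\<close>

text \<open>
  Stepping backwards from a configuration in state \<open>r\<close> by two different displacements
  leads to two different cells, whose contents can be chosen independently; both backward steps are
  then possible from the same configuration.
\<close>

lemma displacement_determined_by_state:
  assumes inj: "inj (head_machine g)"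
    and 1: "g (a1, q1) = (b1, r, d1)" and 2: "g (a2, q2) = (b2, r, d2)"
  shows "d1 = d2"
proof (rule ccontr)
  assume ne: "d1 \<noteq> d2"
  \<comment> \<open>The common image has its head at 0 in state \<open>r\<close>, with \<open>b1\<close> in cell \<open>-d1\<close> and \<open>b2\<close> in cell
    \<open>-d2\<close>; each preimage undoes the writing in one of these cells.\<close>
  define y where "y = (\<lambda>_::int. b1)(- d2 := b2)"
  have "head_machine g (y(- d1 := a1), q1, - d1) = (y, r, 0)"
    using ne by (auto simp: head_machine_def 1 y_def)
  moreover have "head_machine g (y(- d2 := a2), q2, - d2) = (y, r, 0)"
    by (auto simp: head_machine_def 2 y_def)
  ultimately show False
    using inj ne by (metis injD prod.inject neg_equal_iff_equal)
qed

text \<open>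
  Equal new states give equal displacements, so two steps with the same new symbol and state that
  start from the same head position also end at the same head position.
\<close>

lemma inj_write:
  assumes inj: "inj (head_machine g)"
  shows "inj (\<lambda>s. (fst (g s), fst (snd (g s))))"
proof (rule injI, clarify)
  fix a1 q1 a2 q2
  assume "fst (g (a1, q1)) = fst (g (a2, q2))" "fst (snd (g (a1, q1))) = fst (snd (g (a2, q2)))"
  then obtain b r d1 d2 where g: "g (a1, q1) = (b, r, d1)" "g (a2, q2) = (b, r, d2)"
    by (metis prod.collapse)
  have "d1 = d2"
    using displacement_determined_by_state[OF inj g] .
  \<comment> \<open>The two tapes agree away from the head, where the written symbol hides their difference.\<close>
  have "head_machine g ((\<lambda>_. b)(0 := a1), q1, 0) = head_machine g ((\<lambda>_. b)(0 := a2), q2, 0)"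
    using \<open>d1 = d2\<close> by (simp add: head_machine_def g)
  then show "a1 = a2 \<and> q1 = q2"
    using injD[OF inj] by (metis fun_upd_same prod.inject)
qed

lemma inj_head_machine_factorization:
  fixes g :: "'s::finite \<times> 'q::finite \<Rightarrow> 's \<times> 'q \<times> int"
  assumes inj: "inj (head_machine g)"
  obtains \<pi> \<delta> where "bij \<pi>" and "\<And>r. \<delta> r \<in> range (\<lambda>s. snd (snd (g s)))"
    and "head_machine g = state_shift \<delta> \<circ> head_permutation \<pi>"
proof -
  define \<pi> where "\<pi> = (\<lambda>s. (fst (g s), fst (snd (g s))))"
  have bij: "bij \<pi>"
    unfolding \<pi>_def by (intro bijI finite_UNIV_inj_surj inj_write[OF inj] finite)
  \<comment> \<open>Every state is the new state of some step because \<open>\<pi>\<close> is onto; \<open>undefined\<close> is an arbitrary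
    symbol to be written in that step.\<close>
  define \<delta> where "\<delta> = (\<lambda>r. snd (snd (g (inv_into UNIV \<pi> (undefined, r)))))"
  have "g s = (fst (\<pi> s), snd (\<pi> s), \<delta> (snd (\<pi> s)))" for s
  proof -
    let ?t = "inv_into UNIV \<pi> (undefined, snd (\<pi> s))"
    have "\<pi> ?t = (undefined, snd (\<pi> s))"
      using bij by (simp add: bij_is_surj surj_f_inv_f)
    then have "fst (snd (g ?t)) = fst (snd (g s))"
      by (simp add: \<pi>_def)
    then have "snd (snd (g ?t)) = snd (snd (g s))"
      using displacement_determined_by_state[OF inj] by (metis prod.collapse)
    then show ?thesis
      by (simp add: \<pi>_def \<delta>_def)
  qed
  then have "head_machine g = state_shift \<delta> \<circ> head_permutation \<pi>"
    by (simp add: head_machine_def state_shift_def head_permutation_def fun_eq_iff case_prod_unfold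
        Let_def)
  with bij show ?thesis
    by (intro that[of \<pi> \<delta>]) (auto simp: \<delta>_def)
qed

theorem proposition4p4:
  fixes T :: "('s::finite, 'q::finite) machine"
  assumes "T \<in> carrier TM" and "classical T"
  shows "(reversible T \<longleftrightarrow>
            (\<exists>T0 T1. state_symbol_permutation T0 \<and> state_dependent_shift T1 \<and> T = T1 \<circ> T0)) \<and>
         (reversible T \<longrightarrow> T \<in> EL)"
proof -
  have factor: "\<exists>T0 T1. state_symbol_permutation T0 \<and> state_dependent_shift T1 \<and> T = T1 \<circ> T0"
    if "reversible T"
  proof -
    obtain g where g: "T = head_machine g" "\<And>s. snd (snd (g s)) \<in> {-1, 0, 1}"
      using classical_imp_head_machine[OF assms(2)] by blast
    have "inj (head_machine g)"
      using reversible_imp_inj[OF that] unfolding g(1) .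
    then obtain \<pi> \<delta> where factors: "bij \<pi>" "\<And>r. \<delta> r \<in> range (\<lambda>s. snd (snd (g s)))"
      "T = state_shift \<delta> \<circ> head_permutation \<pi>"
      unfolding g(1) by (rule inj_head_machine_factorization) blast
    have "\<delta> r \<in> {-1, 0, 1}" for r
    proof -
      obtain s where "\<delta> r = snd (snd (g s))"
        using factors(2) by blast
      then show ?thesis
        using g(2)[of s] by simp
    qed
    then show ?thesis
      using factors(1,3) state_symbol_permutation_iff state_dependent_shift_state_shift by blast
  qed
  then show ?thesis
    using permutation_then_shift_in_EL EL_subset_reversible by metis
qed

end
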